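(* Let $m\in\mathbb{R}^{\mathcal{P}(N)}$. Then: (i) $m\in\mathcal{K}(N)$ if and only if $T_\iota(m)\in\mathcal{K}(N)$, and the independency model induced by $T_\iota(m)$ is determined as follows: for any $\langle a,b|C\rangle\in\mathcal{E}(N)$, $$a\perp b\mid C\ [T_\iota(m)]\iff a\perp b\mid N\setminus(a\cup b\cup C)\ [m].$$ In particular, $T_\iota$ maps $\mathcal{K}(N)$ onto $\mathcal{K}(N)$. (ii) $T_\iota$ maps faces of $\mathcal{K}(N)$ to faces of $\mathcal{K}(N)$ and preserves inclusion: $G\subseteq F$ if and only if $T_\iota(G)\subseteq T_\iota(F)$ for any $G,F\subseteq\mathbb{R}^{\mathcal{P}(N)}$. In particular, $m\in\mathcal{K}(N)$ is extreme in $\mathcal{K}(N)$ if and only if $T_\iota(m)$ is extreme in $\mathcal{K}(N)$.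
   Context: $N$ is a finite set with $|N|\ge 2$ and $\mathcal{P}(N)$ is its power set; a singleton $\{a\}$ is written $a$. $\mathbb{R}^{\mathcal{P}(N)}$ is the space of functions $m:\mathcal{P}(N)\to\mathbb{R}$ with scalar product $\langle m,u\rangle=\sum_{A\subseteq N}m(A)u(A)$. A function $m$ is supermodular if $m(A)+m(B)\le m(A\cup B)+m(A\cap B)$ for all $A,B\subseteq N$; $\mathcal{K}(N)$ is the cone of supermodular functions. $\mathcal{E}(N)$ is the set of triplets $\langle a,b|C\rangle$ with $a,b\in N$ distinct and $C\subseteq N\setminus\{a,b\}$. For $m\in\mathbb{R}^{\mathcal{P}(N)}$, $a\perp b\mid C\ [m]$ means $m(a\cup b\cup C)+m(C)-m(a\cup C)-m(b\cup C)=0$. The independency model induced by $m\in\mathcal{K}(N)$ is the set of $\langle a,b|C\rangle\in\mathcal{E}(N)$ with $a\perp b\mid C\ [m]$. A face of a convex cone $K\subseteq\mathbb{R}^{\mathcal{P}(N)}$ is a set $\{m\in K: k=\langle m,v\rangle\}$, where $v\in\mathbb{R}^{\mathcal{P}(N)}$, $k\in\mathbb{R}$ satisfy $k\le\langle m,v\rangle$ for all $m\in K$. The non-empty faces of $\mathcal{K}(N)$ form a lattice under inclusion with least element the space of modular functions $\mathcal{K}(N)\cap(-\mathcal{K}(N))$. A function $m\in\mathcal{K}(N)$ is extreme in $\mathcal{K}(N)$ if the smallest face of $\mathcal{K}(N)$ containing $m$ is an atom of this lattice. The reflection transformation $T_\iota:\mathbb{R}^{\mathcal{P}(N)}\to\mathbb{R}^{\mathcal{P}(N)}$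 is $[T_\iota(m)](S)=m(N\setminus S)$ for $S\subseteq N$. *)

theory Defs
  imports "HOL-Analysis.Analysis"
begin

text \<open>
  The finite set \<open>N\<close> is the universe of a type \<open>'n\<close> of class \<open>finite\<close>, so that \<open>\<P>(N)\<close> is the
  type \<open>'n set\<close> and the space of functions \<open>\<P>(N) \<rightarrow> \<real>\<close> is the type \<open>real ^ ('n set)\<close>, whose
  library inner product is the scalar product \<open>\<Sum>A\<subseteq>N. m(A) u(A)\<close>.
\<close>

definition supermodular :: "real ^ ('n::finite set) \<Rightarrow> bool" where
  "supermodular m \<longleftrightarrow> (\<forall>A B. m $ A + m $ B \<le> m $ (A \<union> B) + m $ (A \<inter> B))"

definition supermodular_cone :: "(real ^ ('n::finite set)) set" where
  "supermodular_cone = {m. supermodular m}"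

definition triplets :: "('n \<times> 'n \<times> 'n set) set" where
  "triplets = {(a, b, C). a \<noteq> b \<and> C \<subseteq> UNIV - {a, b}}"

definition indep :: "real ^ ('n::finite set) \<Rightarrow> 'n \<Rightarrow> 'n \<Rightarrow> 'n set \<Rightarrow> bool" where
  "indep m a b C \<longleftrightarrow>
     m $ ({a} \<union> {b} \<union> C) + m $ C - m $ ({a} \<union> C) - m $ ({b} \<union> C) = 0"

definition induced_model :: "real ^ ('n::finite set) \<Rightarrow> ('n \<times> 'n \<times> 'n set) set" where
  "induced_model m = {(a, b, C) \<in> triplets. indep m a b C}"

text \<open>
  Faces of a convex cone are the exposed ones; the empty set may be a face (take \<open>k\<close> small).
  This differs from the library predicate \<open>face_of\<close>.
\<close>

definition is_face :: "'v::real_inner set \<Rightarrow> 'v set \<Rightarrow> bool" where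
  "is_face K F \<longleftrightarrow>
     (\<exists>v k. (\<forall>m\<in>K. k \<le> m \<bullet> v) \<and> F = {m \<in> K. k = m \<bullet> v})"

definition is_smallest_face :: "'v::real_inner set \<Rightarrow> 'v \<Rightarrow> 'v set \<Rightarrow> bool" where
  "is_smallest_face K m F \<longleftrightarrow>
     is_face K F \<and> m \<in> F \<and> (\<forall>G. is_face K G \<and> m \<in> G \<longrightarrow> F \<subseteq> G)"

text \<open>
  Atoms of the lattice of non-empty faces of a convex cone \<open>K\<close>. For the supermodular cone the
  least element of this lattice is \<open>K \<inter> (-K)\<close>, the space of modular functions.
\<close>

definition is_face_atom :: "'v::real_inner set \<Rightarrow> 'v set \<Rightarrow> bool" where
  "is_face_atom K F \<longleftrightarrow>
     is_face K F \<and> F \<noteq> {} \<and> F \<noteq> K \<inter> uminus ` K \<and>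
     (\<forall>G. is_face K G \<and> G \<noteq> {} \<and> G \<subseteq> F \<longrightarrow> G = K \<inter> uminus ` K \<or> G = F)"

definition extreme_in :: "'v::real_inner \<Rightarrow> 'v set \<Rightarrow> bool" where
  "extreme_in m K \<longleftrightarrow> m \<in> K \<and> (\<exists>F. is_smallest_face K m F \<and> is_face_atom K F)"

definition reflection :: "real ^ ('n::finite set) \<Rightarrow> real ^ ('n set)" where
  "reflection m = (\<chi> S. m $ (UNIV - S))"

end

(* The reflection is a self-adjoint linear involution, and it maps the supermodular cone onto itself
   because complementation exchanges unions and intersections. By self-adjointness the face cut out
   by v is sent to the face cut out by the reflection of v, so any such map induces an automorphism
   of the lattice of faces. *)

theory Submission imports Defs begin

text \<open>The part about faces is isolated here because it depends only on these three properties,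
  not on set functions or supermodularity.\<close>

locale selfadjoint_involution =
  fixes T :: "'v::real_inner \<Rightarrow> 'v" and K :: "'v set"
  assumes involution [simp]: "T (T x) = x"
    and selfadjoint: "T x \<bullet> y = x \<bullet> T y"
    and maps_into: "x \<in> K \<Longrightarrow> T x \<in> K"
begin

lemma mem_iff: "T x \<in> K \<longleftrightarrow> x \<in> K"
  using maps_into[of x] maps_into[of "T x"] by auto

lemma mem_image_iff: "x \<in> T ` A \<longleftrightarrow> T x \<in> A"
  by (metis image_iff involution)

lemma image_image [simp]: "T ` T ` A = A"
  by (auto simp: mem_image_iff)

lemma image_K [simp]: "T ` K = K"
  by (auto simp: mem_image_iff mem_iff)

text \<open>Linearity is not among the axioms of the locale. Self-adjointness supplies what is
  required: inside the inner product \<open>T\<close> moves to the other factor, and the sign comes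
  out.\<close>

lemma minus: "T (- x) = - T x"
proof (rule vector_eq_rdot[THEN iffD1], rule allI)
  fix z
  show "T (- x) \<bullet> z = - T x \<bullet> z"
    by (simp add: selfadjoint)
qed

lemma image_subset_image_iff: "T ` A \<subseteq> T ` B \<longleftrightarrow> A \<subseteq> B"
  by (metis image_image image_mono)

text \<open>This set is the least element in the definition of an atom, so it has to be fixed for
  atoms to be carried to atoms.\<close>

lemma image_lineality [simp]: "T ` (K \<inter> uminus ` K) = K \<inter> uminus ` K"
proof -
  have "x \<in> uminus ` K \<longleftrightarrow> - x \<in> K" for x
    by (metis image_iff minus_minus)
  then show ?thesis
    by (auto simp: mem_image_iff mem_iff simp flip: minus)
qed

lemma is_face_image:
  assumes "is_face K F"
  shows "is_face K (T ` F)"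
proof -
  obtain v k where k: "\<forall>m\<in>K. k \<le> m \<bullet> v" and F: "F = {m \<in> K. k = m \<bullet> v}"
    using assms unfolding is_face_def by blast
  \<comment> \<open>The same \<open>k\<close> works, since \<open>m \<bullet> T v\<close> is the
    value of \<open>v\<close> at \<open>T m\<close>, which lies in \<open>K\<close> again.\<close>
  have "\<forall>m\<in>K. k \<le> m \<bullet> T v"
    using k maps_into by (simp flip: selfadjoint)
  moreover have "T ` F = {m \<in> K. k = m \<bullet> T v}"
    by (auto simp: F mem_image_iff mem_iff selfadjoint)
  ultimately show ?thesis
    unfolding is_face_def by blast
qed

lemma is_smallest_face_image:
  assumes "is_smallest_face K m F"
  shows "is_smallest_face K (T m) (T ` F)"
proof -
  have "T ` F \<subseteq> G" if "is_face K G" "T m \<in> G" for G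
  proof -
    \<comment> \<open>The competitor \<open>G\<close> is pulled back to a face containing
      \<open>m\<close>, where minimality of \<open>F\<close> applies.\<close>
    have "F \<subseteq> T ` G"
      using assms that is_face_image[of G] unfolding is_smallest_face_def
      by (simp add: mem_image_iff)
    then show ?thesis
      by (metis image_image image_mono)
  qed
  then show ?thesis
    using assms is_face_image[of F] unfolding is_smallest_face_def by simp
qed

lemma is_face_atom_image:
  assumes "is_face_atom K F"
  shows "is_face_atom K (T ` F)"
proof -
  have "G = K \<inter> uminus ` K \<or> G = T ` F" if "is_face K G" "G \<noteq> {}" "G \<subseteq> T ` F" for G
  proof -
    have "T ` G \<subseteq> F"
      using that(3) by (metis image_image image_mono)
    then have *: "T ` G = K \<inter> uminus ` K \<or> T ` G = F"
      using assms that(1,2) is_face_image[of G] unfolding is_face_atom_def by simp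
    \<comment> \<open>Applying \<open>T\<close> to both alternatives returns to \<open>G\<close>,
      and the first alternative is fixed by \<open>T\<close>.\<close>
    have "T ` T ` G = K \<inter> uminus ` K \<or> T ` T ` G = T ` F"
      using * by (elim disjE) (simp_all only: image_lineality simp_thms)
    then show ?thesis
      by simp
  qed
  moreover have "T ` F \<noteq> K \<inter> uminus ` K"
    using assms image_image[of F] unfolding is_face_atom_def by (metis image_lineality)
  ultimately show ?thesis
    using assms is_face_image[of F] unfolding is_face_atom_def by simp
qed

lemma extreme_in_iff: "extreme_in (T m) K \<longleftrightarrow> extreme_in m K"
proof -
  \<comment> \<open>One implication for arbitrary \<open>x\<close> suffices: at \<open>T m\<close>
    it becomes the converse, by involutivity.\<close>
  have "extreme_in (T x) K" if "extreme_in x K" for x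
    using that maps_into[of x] is_smallest_face_image[of x] is_face_atom_image
    unfolding extreme_in_def by meson
  from this[of m] this[of "T m"] show ?thesis
    by auto
qed

end

lemma reflection_nth [simp]: "reflection m $ S = m $ (- S)"
  by (simp add: reflection_def Compl_eq_Diff_UNIV)

lemma supermodular_reflection:
  assumes "supermodular m"
  shows "supermodular (reflection m)"
  unfolding supermodular_def
proof (intro allI)
  fix A B
  \<comment> \<open>By De Morgan the union and intersection on the right trade places, which leaves
    their sum unchanged.\<close>
  have "m $ (- A) + m $ (- B) \<le> m $ (- A \<union> - B) + m $ (- A \<inter> - B)"
    using assms by (simp only: supermodular_def)
  then show "reflection m $ A + reflection m $ B
      \<le> reflection m $ (A \<union> B) + reflection m $ (A \<inter> B)"
    by (simp only: reflection_nth Compl_Un Compl_Int add.commute)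
qed

interpretation reflection: selfadjoint_involution reflection supermodular_cone
proof
  show "reflection (reflection x) = x" for x :: "real ^ ('n::finite set)"
    by (simp add: vec_eq_iff)
  show "reflection x \<bullet> y = x \<bullet> reflection y" for x y :: "real ^ ('n::finite set)"
    unfolding inner_vec_def
    \<comment> \<open>Here \<open>uminus\<close> is set complement, a bijection of the index type
      that shifts the reflection from one factor to the other.\<close>
    by (rule sum.reindex_bij_witness[of _ uminus uminus]) auto
  show "reflection x \<in> supermodular_cone"
    if "x \<in> supermodular_cone" for x :: "real ^ ('n::finite set)"
    using that by (simp add: supermodular_cone_def supermodular_reflection)
qed

lemma indep_reflection:
  assumes "(a, b, C) \<in> triplets"
  shows "indep (reflection m) a b C \<longleftrightarrow> indep m a b (UNIV - ({a} \<union> {b} \<union> C))"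
proof -
  let ?D = "UNIV - ({a} \<union> {b} \<union> C)"
  \<comment> \<open>Complementation swaps the two sets with positive sign with those built from
    \<open>?D\<close>, and likewise the two with negative sign. The last three equations rest on
    \<open>a\<close>, \<open>b\<close> being distinct and outside \<open>C\<close>.\<close>
  have *: "- ({a} \<union> {b} \<union> C) = ?D" "- C = {a} \<union> {b} \<union> ?D"
    "- ({a} \<union> C) = {b} \<union> ?D" "- ({b} \<union> C) = {a} \<union> ?D"
    using assms by (auto simp: triplets_def)
  show ?thesis
    unfolding indep_def reflection_nth * by linarith
qed

lemma induced_model_reflection:
  "induced_model (reflection m) =
     {(a, b, C) \<in> triplets. (a, b, UNIV - ({a} \<union> {b} \<union> C)) \<in> induced_model m}"
proof -
  \<comment> \<open>With this, membership of the complementary triplet in the model of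
    \<open>m\<close> reduces to \<open>indep\<close> alone.\<close>
  have "(a, b, UNIV - ({a} \<union> {b} \<union> C)) \<in> triplets" if "(a, b, C) \<in> triplets"
    for a b :: 'a and C
    using that by (auto simp: triplets_def)
  then show ?thesis
    unfolding induced_model_def by (auto simp: indep_reflection)
qed

theorem mainTheorem2:
  fixes m :: "real ^ ('n::finite set)"
  assumes "CARD('n) \<ge> 2"
  shows
    "((m \<in> supermodular_cone \<longleftrightarrow> reflection m \<in> supermodular_cone) \<and>
      (\<forall>a b C. (a, b, C) \<in> triplets \<longrightarrow>
         (indep (reflection m) a b C \<longleftrightarrow> indep m a b (UNIV - ({a} \<union> {b} \<union> C)))) \<and>
      (m \<in> supermodular_cone \<longrightarrow>
         induced_model (reflection m) =
           {(a, b, C) \<in> triplets. (a, b, UNIV - ({a} \<union> {b} \<union> C)) \<in> induced_model m}) \<and>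
      reflection ` (supermodular_cone :: (real ^ ('n set)) set) = supermodular_cone)
     \<and>
     ((\<forall>F :: (real ^ ('n set)) set.
         is_face supermodular_cone F \<longrightarrow> is_face supermodular_cone (reflection ` F)) \<and>
      (\<forall>G F :: (real ^ ('n set)) set. G \<subseteq> F \<longleftrightarrow> reflection ` G \<subseteq> reflection ` F) \<and>
      (m \<in> supermodular_cone \<longrightarrow>
         (extreme_in m supermodular_cone \<longleftrightarrow> extreme_in (reflection m) supermodular_cone)))"
proof (intro conjI)
  show "m \<in> supermodular_cone \<longleftrightarrow> reflection m \<in> supermodular_cone"
    by (rule reflection.mem_iff[symmetric])
  show "\<forall>a b C. (a, b, C) \<in> triplets \<longrightarrow>
      (indep (reflection m) a b C \<longleftrightarrow> indep m a b (UNIV - ({a} \<union> {b} \<union> C)))"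
    by (intro allI impI indep_reflection)
  show "m \<in> supermodular_cone \<longrightarrow> induced_model (reflection m) =
      {(a, b, C) \<in> triplets. (a, b, UNIV - ({a} \<union> {b} \<union> C)) \<in> induced_model m}"
    by (rule impI, rule induced_model_reflection)
  show "reflection ` (supermodular_cone :: (real ^ ('n set)) set) = supermodular_cone"
    by (rule reflection.image_K)
  show "\<forall>F :: (real ^ ('n set)) set.
      is_face supermodular_cone F \<longrightarrow> is_face supermodular_cone (reflection ` F)"
    by (intro allI impI reflection.is_face_image)
  show "\<forall>G F :: (real ^ ('n set)) set. G \<subseteq> F \<longleftrightarrow> reflection ` G \<subseteq> reflection ` F"
    by (intro allI reflection.image_subset_image_iff[symmetric])
  show "m \<in> supermodular_cone \<longrightarrow>
      (extreme_in m supermodular_cone \<longleftrightarrow> extreme_in (reflection m) supermodular_cone)"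
    by (rule impI, rule reflection.extreme_in_iff[symmetric])
qed

end
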